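(* Let $f^1,\dots,f^p:\mathbb{R}^n\to\mathbb{R}^m$ be twice continuously differentiable and $F(x)=\{f^1(x),\dots,f^p(x)\}$. Let $\bar x$ be a weakly minimal solution of the problem of minimizing $F$ over $\mathbb{R}^n$ with respect to the lower set less relation, and let $\bar a\in P_{\bar x}$ and $\bar u\in\mathbb{R}^n$ be such that $\Phi(\bar x)=\xi_{\bar x}(\bar a,\bar u)$. Then $\bar u=0$.
   Context: $K\subset\mathbb{R}^m$ is a closed, convex, pointed cone with nonempty interior, and $e\in\mathrm{int}(K)$ is fixed. The Gerstewitz function is $\mathcal{G}_e(y)=\min\{t\in\mathbb{R}: te\in y+K\}$. For nonempty $A,B\subseteq\mathbb{R}^m$: $A\prec^l B$ iff $B\subseteq A+\mathrm{int}(K)$. A point $\bar x$ is a weakly minimal solution if there is no $x\in\mathbb{R}^n$ with $F(x)\prec^l F(\bar x)$. For $A\subseteq\mathbb{R}^m$, $\mathrm{Min}(A,K)=\{z\in A:(z-K)\cap A=\{z\}\}$. Put $I(x)=\{i: f^i(x)\in\mathrm{Min}(F(x),K)\}$, $I_r(x)=\{i\in I(x): f^i(x)=r\}$, $w(x)=|\mathrm{Min}(F(x),K)|$. Enumerating $\mathrm{Min}(F(x),K)=\{r_1^x,\dots,r_{w(x)}^x\}$, the partition set at $x$ is $P_x=\prod_{j=1}^{w(x)} I_{r_j^x}(x)$, with elements $a=(a_1,\dots,a_{w(x)})$. $\nabla f^i(x)\in\mathbb{R}^{n\times m}$ denotes the transposed Jacobian, so $\nabla f^i(x)^\top u\in\mathbb{R}^m$.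 For each $i$ and $x$, $B^i(x)=(B^{i,1}(x),\dots,B^{i,m}(x))$ is an $m$-tuple of symmetric real $n\times n$ matrices (Hessian approximation), $u^\top B^i(x)u:=(u^\top B^{i,l}(x)u)_{l=1}^m\in\mathbb{R}^m$, and $B^i(x)$ is positive definite in the sense that $u^\top B^i(x)u\in\mathrm{int}(K)$ for all $u\neq0$. $\xi_x(a,u)=\max_{1\le j\le w(x)}\mathcal{G}_e\big(\nabla f^{a_j}(x)^\top u+\tfrac12u^\top B^{a_j}(x)u\big)$ for $a\in P_x,\ u\in\mathbb{R}^n$, and $\Phi(x)=\min_{(a,u)\in P_x\times\mathbb{R}^n}\xi_x(a,u)$. *)

theory Defs
  imports "HOL-Analysis.Analysis"
begin

definition pointed :: "'a::real_vector set \<Rightarrow> bool" where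
  "pointed K \<longleftrightarrow> K \<inter> uminus ` K = {0}"

(* The first and second Frechet derivatives are bounded linear maps, and continuity is
   continuity in the operator norm. *)
definition twice_continuously_differentiable ::
    "('a::real_normed_vector \<Rightarrow> 'b::real_normed_vector) \<Rightarrow> bool" where
  "twice_continuously_differentiable g \<longleftrightarrow>
     (\<exists>(g' :: 'a \<Rightarrow> 'a \<Rightarrow>\<^sub>L 'b) (g'' :: 'a \<Rightarrow> 'a \<Rightarrow>\<^sub>L ('a \<Rightarrow>\<^sub>L 'b)).
        (\<forall>x. (g has_derivative blinfun_apply (g' x)) (at x)) \<and>
        (\<forall>x. (g' has_derivative blinfun_apply (g'' x)) (at x)) \<and>
        continuous_on UNIV g'')"

(* LEAST is the minimum of the set. It exists when K is a closed, convex, pointed cone and e is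
   an interior point of K. *)
definition gerstewitz :: "'a::real_normed_vector set \<Rightarrow> 'a \<Rightarrow> 'a \<Rightarrow> real" where
  "gerstewitz K e y = (LEAST t. t *\<^sub>R e \<in> {y} + K)"

definition lower_less :: "'a::real_normed_vector set \<Rightarrow> 'a set \<Rightarrow> 'a set \<Rightarrow> bool" where
  "lower_less K A B \<longleftrightarrow> B \<subseteq> A + interior K"

definition weakly_minimal_solution ::
    "'b::real_normed_vector set \<Rightarrow> ('a \<Rightarrow> 'b set) \<Rightarrow> 'a \<Rightarrow> bool" where
  "weakly_minimal_solution K F x0 \<longleftrightarrow> \<not> (\<exists>x. lower_less K (F x) (F x0))"

definition minimal_elements :: "'a::real_vector set \<Rightarrow> 'a set \<Rightarrow> 'a set" where
  "minimal_elements A K = {z \<in> A. (\<lambda>k. z - k) ` K \<inter> A = {z}}"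

definition set_map :: "nat \<Rightarrow> (nat \<Rightarrow> 'a \<Rightarrow> 'b) \<Rightarrow> 'a \<Rightarrow> 'b set" where
  "set_map p f x = (\<lambda>i. f i x) ` {1..p}"

definition active_indices ::
    "'b::real_vector set \<Rightarrow> nat \<Rightarrow> (nat \<Rightarrow> 'a \<Rightarrow> 'b) \<Rightarrow> 'a \<Rightarrow> nat set" where
  "active_indices K p f x = {i \<in> {1..p}. f i x \<in> minimal_elements (set_map p f x) K}"

definition active_indices_at ::
    "'b::real_vector set \<Rightarrow> nat \<Rightarrow> (nat \<Rightarrow> 'a \<Rightarrow> 'b) \<Rightarrow> 'b \<Rightarrow> 'a \<Rightarrow> nat set" where
  "active_indices_at K p f r x = {i \<in> active_indices K p f x. f i x = r}"

definition num_minimal :: "'b::real_vector set \<Rightarrow> nat \<Rightarrow> (nat \<Rightarrow> 'a \<Rightarrow> 'b) \<Rightarrow> 'a \<Rightarrow> nat" where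
  "num_minimal K p f x = card (minimal_elements (set_map p f x) K)"

definition minimal_enumeration ::
    "'b::real_vector set \<Rightarrow> nat \<Rightarrow> (nat \<Rightarrow> 'a \<Rightarrow> 'b) \<Rightarrow> ('a \<Rightarrow> nat \<Rightarrow> 'b) \<Rightarrow> bool" where
  "minimal_enumeration K p f r \<longleftrightarrow>
     (\<forall>x. bij_betw (r x) {1..num_minimal K p f x} (minimal_elements (set_map p f x) K))"

(* The partition set depends on the enumeration r x 1, r x 2, ... of the minimal elements;
   a tuple is a function that is undefined outside {1..num_minimal K p f x}. *)
definition partition_set ::
    "'b::real_vector set \<Rightarrow> nat \<Rightarrow> (nat \<Rightarrow> 'a \<Rightarrow> 'b) \<Rightarrow> ('a \<Rightarrow> nat \<Rightarrow> 'b) \<Rightarrow> 'a \<Rightarrow> (nat \<Rightarrow> nat) set" where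
  "partition_set K p f r x =
     (\<Pi>\<^sub>E j\<in>{1..num_minimal K p f x}. active_indices_at K p f (r x j) x)"

definition gradient :: "(real^'n \<Rightarrow> real^'m) \<Rightarrow> real^'n \<Rightarrow> real^'m^'n" where
  "gradient g x = transpose (matrix (frechet_derivative g (at x)))"

(* An m-tuple of n x n matrices is a vector of matrices, with l-th entry H $ l. *)
definition quad_form :: "real^'n^'n^'m \<Rightarrow> real^'n \<Rightarrow> real^'m" where
  "quad_form H u = (\<chi> l. u \<bullet> (H $ l *v u))"

definition hessian_approximation :: "(real^'m) set \<Rightarrow> real^'n^'n^'m \<Rightarrow> bool" where
  "hessian_approximation K H \<longleftrightarrow>
     (\<forall>l. transpose (H $ l) = H $ l) \<and> (\<forall>u. u \<noteq> 0 \<longrightarrow> quad_form H u \<in> interior K)"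

definition xi ::
    "(real^'m) set \<Rightarrow> real^'m \<Rightarrow> nat \<Rightarrow> (nat \<Rightarrow> real^'n \<Rightarrow> real^'m) \<Rightarrow>
     (nat \<Rightarrow> real^'n \<Rightarrow> real^'n^'n^'m) \<Rightarrow> real^'n \<Rightarrow> (nat \<Rightarrow> nat) \<Rightarrow> real^'n \<Rightarrow> real" where
  "xi K e p f B x a u =
     Max ((\<lambda>j. gerstewitz K e
              (transpose (gradient (f (a j)) x) *v u + (1/2) *\<^sub>R quad_form (B (a j) x) u))
          ` {1..num_minimal K p f x})"

(* LEAST is again an attained minimum: the partition set is finite and nonempty, and xi is
   continuous and coercive in u because the matrices are positive definite with respect to K. *)
definition Phi ::
    "(real^'m) set \<Rightarrow> real^'m \<Rightarrow> nat \<Rightarrow> (nat \<Rightarrow> real^'n \<Rightarrow> real^'m) \<Rightarrow>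
     (nat \<Rightarrow> real^'n \<Rightarrow> real^'n^'n^'m) \<Rightarrow> (real^'n \<Rightarrow> nat \<Rightarrow> real^'m) \<Rightarrow> real^'n \<Rightarrow> real" where
  "Phi K e p f B r x =
     (LEAST v. v \<in> (\<lambda>(a, u). xi K e p f B x a u) ` (partition_set K p f r x \<times> UNIV))"

end

theory Submission imports Defs begin

text \<open>
  The order of \<open>K\<close> is scalarised by \<open>gerstewitz K e\<close>, whose sublevel sets are translates of
  \<open>- K\<close>: its value at \<open>y\<close> is at most \<open>t\<close> iff \<open>y\<close> lies below \<open>t *\<^sub>R e\<close>
  (\<open>gerstewitz_le_iff\<close>). Its sign therefore tests membership in \<open>- K\<close>.

  Evaluating at the zero step shows that the optimal value of the quadratic model is at most \<open>0\<close>.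
  So every model value \<open>D u + (1/2) *\<^sub>R q u\<close> at an optimal pair \<open>(a, u)\<close> lies in \<open>- K\<close>, where
  \<open>D\<close> is the derivative of the selected component and \<open>q\<close> its quadratic form. If \<open>u \<noteq> 0\<close>, then
  \<open>q u\<close> is interior to \<open>K\<close>, which forces \<open>D u\<close> into the interior of \<open>- K\<close>. Hence a short step
  along \<open>u\<close> strictly improves all selected components at once
  (\<open>eventually_descent_along_direction\<close>). These components attain every minimal element of the
  finite image set, and every element of that set is dominated by a minimal one
  (\<open>dominated_by_minimal_element\<close>), so the new image set is strictly lower, contradicting weak
  minimality.

  The optimal value is defined by \<open>LEAST\<close>, which says something about other values only when a
  least value exists. The analytic part of the argument supplies this: the scalarisation is
  Lipschitz, and the positive definite quadratic term outgrows the linear one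
  (\<open>quadratic_model_nonneg_outside_ball\<close>), so each function \<open>xi K e p f B x a\<close> has a
  global minimiser, which lies in some ball; only finitely many tuples \<open>a\<close> compete.
\<close>

section \<open>Closed pointed convex cones and the Gerstewitz function\<close>

locale solid_pointed_cone =
  fixes K :: "'a::euclidean_space set" and e :: 'a
  assumes closed: "closed K" and convex: "convex K" and cone: "cone K"
    and pointed: "pointed K" and e_interior: "e \<in> interior K"
begin

lemma add_mem: "x \<in> K \<Longrightarrow> y \<in> K \<Longrightarrow> x + y \<in> K"
  using convex cone convex_cone[of K] by blast

lemma scaleR_mem: "x \<in> K \<Longrightarrow> 0 \<le> c \<Longrightarrow> c *\<^sub>R x \<in> K"
  using cone mem_cone by blast

lemma e_mem: "e \<in> K"
  using e_interior interior_subset by blast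

lemma zero_mem: "0 \<in> K"
  using scaleR_mem[OF e_mem, of 0] by simp

lemma both_signs_imp_zero: "x \<in> K \<Longrightarrow> - x \<in> K \<Longrightarrow> x = 0"
  using pointed unfolding pointed_def by force

text \<open>If \<open>0\<close> were interior, \<open>K\<close> would contain a whole line.\<close>

lemma zero_not_interior: "0 \<notin> interior K"
proof
  assume "0 \<in> interior K"
  then obtain d where d: "d > 0" "cball 0 d \<subseteq> K"
    unfolding mem_interior_cball by blast
  obtain b :: 'a where b: "b \<in> Basis" using nonempty_Basis by blast
  have "d *\<^sub>R b \<in> K" "- (d *\<^sub>R b) \<in> K" using d b by auto
  then have "d *\<^sub>R b = 0" by (rule both_signs_imp_zero)
  then show False using d b by auto
qed

lemma minus_interior_notin: "x \<in> interior K \<Longrightarrow> - x \<notin> K"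
  using both_signs_imp_zero zero_not_interior interior_subset by fastforce

lemma add_mem_interior:
  assumes "x \<in> interior K" "y \<in> K"
  shows "x + y \<in> interior K"
proof -
  have "(+) y ` interior K \<subseteq> interior K"
  proof (rule interior_maximal)
    show "(+) y ` interior K \<subseteq> K" using add_mem assms(2) interior_subset by blast
    show "open ((+) y ` interior K)" by (simp add: open_translation)
  qed
  then show ?thesis using assms(1) by (auto simp: add.commute)
qed

lemma scaleR_mem_interior:
  assumes "x \<in> interior K" "c > 0"
  shows "c *\<^sub>R x \<in> interior K"
proof -
  have "(*\<^sub>R) c ` interior K \<subseteq> interior K"
  proof (rule interior_maximal)
    show "(*\<^sub>R) c ` interior K \<subseteq> K"
      using scaleR_mem assms(2) interior_subset by fastforce
    show "open ((*\<^sub>R) c ` interior K)" using assms(2) by (intro open_scaling) auto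
  qed
  then show ?thesis using assms(1) by auto
qed

text \<open>
  Since \<open>e\<close> is interior, the cone contains a ball around \<open>e\<close> and hence, after scaling, a ball around \<open>t *\<^sub>R e\<close> whose radius
  is proportional to \<open>t\<close>. This gives both the existence of the Gerstewitz minimum and its
  Lipschitz constant.
\<close>

lemma e_dominates_norm:
  obtains M where "M > 0" "\<And>y t. M * norm y \<le> t \<Longrightarrow> t *\<^sub>R e - y \<in> K"
proof -
  obtain d where d: "d > 0" "cball e d \<subseteq> K"
    using e_interior unfolding mem_interior_cball by blast
  have "t *\<^sub>R e - y \<in> K" if "(1/d) * norm y \<le> t" for y t
  proof (cases "t = 0")
    case True
    then have "norm y = 0"
      using that d(1) by (simp add: divide_le_0_iff)
    then show ?thesis using True zero_mem by simp
  next
    case False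
    have "0 \<le> t" using that d(1) by (meson order_trans zero_le_mult_iff norm_ge_zero less_imp_le zero_le_divide_1_iff)
    then have t: "t > 0" using False by simp
    have "norm ((1/t) *\<^sub>R y) \<le> d" using that t d(1) by (simp add: field_simps)
    then have "e - (1/t) *\<^sub>R y \<in> K" using d(2) by (auto simp: dist_norm)
    then have "t *\<^sub>R (e - (1/t) *\<^sub>R y) \<in> K" using t by (intro scaleR_mem) auto
    then show ?thesis using t by (simp add: algebra_simps)
  qed
  then show thesis using that[of "1/d"] d(1) by simp
qed

text \<open>
  The admissible \<open>t\<close> form a closed upward ray. It is bounded below because
  \<open>K\<close> contains no negative multiple of \<open>e\<close>, which is where pointedness is used.
\<close>

lemma gerstewitz_le_iff: "gerstewitz K e y \<le> t \<longleftrightarrow> t *\<^sub>R e - y \<in> K"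
proof -
  define S where "S = {t. t *\<^sub>R e - y \<in> K}"
  obtain M where M: "M > 0" "\<And>y t. M * norm y \<le> t \<Longrightarrow> t *\<^sub>R e - y \<in> K"
    by (rule e_dominates_norm) blast
  have "closed S"
    unfolding S_def
    using continuous_closed_vimage[OF closed, of "\<lambda>t. t *\<^sub>R e - y"]
    by (simp add: vimage_def)
  moreover have "S \<noteq> {}" using M(2)[of y "M * norm y"] by (auto simp: S_def)
  moreover have "- (M * norm y) \<le> s" if "s \<in> S" for s
  proof (rule ccontr)
    assume neg: "\<not> ?thesis"
    define c where "c = - (s + M * norm y)"
    have c: "c > 0" using neg by (simp add: c_def)
    have "(s *\<^sub>R e - y) + ((M * norm y) *\<^sub>R e - (- y)) \<in> K"
      using that M(2)[of "- y"] by (intro add_mem) (auto simp: S_def)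
    also have "(s *\<^sub>R e - y) + ((M * norm y) *\<^sub>R e - (- y)) = c *\<^sub>R (- e)"
      by (simp add: c_def algebra_simps)
    finally have "(1 / c) *\<^sub>R c *\<^sub>R (- e) \<in> K"
      by (rule scaleR_mem) (use c in simp)
    then have "- e \<in> K" using c by simp
    then show False using minus_interior_notin e_interior by blast
  qed
  then have bdd: "bdd_below S" by (auto simp: bdd_below_def)
  ultimately have Inf_mem: "Inf S \<in> S" by (intro closed_contains_Inf) auto
  have "gerstewitz K e y = (LEAST t. t \<in> S)"
    unfolding gerstewitz_def
  proof (rule arg_cong[where f = Least], rule ext)
    fix t :: real
    show "t *\<^sub>R e \<in> {y} + K \<longleftrightarrow> t \<in> S"
      unfolding S_def set_plus_def by (auto intro!: bexI[of _ "t *\<^sub>R e - y"])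
  qed
  also have "\<dots> = Inf S"
    using Inf_mem bdd by (intro Least_equality) (auto intro: cInf_lower)
  finally have G: "gerstewitz K e y = Inf S" .
  show ?thesis
  proof
    assume "gerstewitz K e y \<le> t"
    then have "(t - Inf S) *\<^sub>R e + (Inf S *\<^sub>R e - y) \<in> K"
      using Inf_mem e_mem G by (intro add_mem scaleR_mem) (auto simp: S_def)
    then show "t *\<^sub>R e - y \<in> K" by (simp add: algebra_simps)
  next
    assume "t *\<^sub>R e - y \<in> K"
    then show "gerstewitz K e y \<le> t"
      unfolding G using bdd by (intro cInf_lower) (auto simp: S_def)
  qed
qed

lemma gerstewitz_add_le: "gerstewitz K e (x + y) \<le> gerstewitz K e x + gerstewitz K e y"
proof -
  have "(gerstewitz K e x *\<^sub>R e - x) + (gerstewitz K e y *\<^sub>R e - y) \<in> K"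
    by (intro add_mem) (simp_all flip: gerstewitz_le_iff)
  then show ?thesis by (simp add: gerstewitz_le_iff algebra_simps)
qed

lemma gerstewitz_scaleR_le:
  assumes "c \<ge> 0" shows "gerstewitz K e (c *\<^sub>R y) \<le> c * gerstewitz K e y"
proof -
  have "c *\<^sub>R (gerstewitz K e y *\<^sub>R e - y) \<in> K"
    using assms by (intro scaleR_mem) (simp_all flip: gerstewitz_le_iff)
  then show ?thesis by (simp add: gerstewitz_le_iff algebra_simps)
qed

lemma gerstewitz_scaleR:
  assumes "c > 0" shows "gerstewitz K e (c *\<^sub>R y) = c * gerstewitz K e y"
proof (rule antisym)
  have "gerstewitz K e ((1/c) *\<^sub>R c *\<^sub>R y) \<le> (1/c) * gerstewitz K e (c *\<^sub>R y)"
    using assms by (intro gerstewitz_scaleR_le) auto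
  then show "c * gerstewitz K e y \<le> gerstewitz K e (c *\<^sub>R y)"
    using assms by (simp add: field_simps)
qed (use assms gerstewitz_scaleR_le in auto)

lemma gerstewitz_zero_le: "gerstewitz K e 0 \<le> 0"
  by (simp add: gerstewitz_le_iff zero_mem)

lemma gerstewitz_pos:
  assumes "y \<in> interior K" shows "gerstewitz K e y > 0"
  using minus_interior_notin[OF assms] gerstewitz_le_iff[of y 0] by force

lemma gerstewitz_le_norm:
  obtains M where "M > 0" "\<And>y. gerstewitz K e y \<le> M * norm y"
  using e_dominates_norm gerstewitz_le_iff by (metis order_refl)

lemma continuous_on_gerstewitz: "continuous_on S (gerstewitz K e)"
proof -
  obtain M where M: "M > 0" "\<And>y. gerstewitz K e y \<le> M * norm y"
    by (rule gerstewitz_le_norm) blast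
  have le: "gerstewitz K e x - gerstewitz K e y \<le> M * norm (x - y)" for x y
    using gerstewitz_add_le[of "x - y" y] M(2)[of "x - y"] by simp
  have "M-lipschitz_on S (gerstewitz K e)"
  proof (rule lipschitz_onI)
    fix x y
    show "dist (gerstewitz K e x) (gerstewitz K e y) \<le> M * dist x y"
      using le[of x y] le[of y x] by (auto simp: dist_norm norm_minus_commute abs_le_iff)
  qed (use M in simp)
  then show ?thesis by (rule lipschitz_on_continuous_on)
qed

text \<open>
  On the unit sphere the quadratic term has scalarised values bounded below by some \<open>m > 0\<close>, by
  compactness, so its scalarisation grows like \<open>m * (norm u)\<^sup>2\<close>; by sublinearity the linear term
  costs at most a multiple of \<open>norm u\<close>.
\<close>

lemma quadratic_model_nonneg_outside_ball:
  fixes L q :: "'b::euclidean_space \<Rightarrow> 'a"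
  assumes L: "bounded_linear L" and q: "continuous_on UNIV q"
    and hom: "\<And>c u. q (c *\<^sub>R u) = c\<^sup>2 *\<^sub>R q u"
    and pos: "\<And>u. u \<noteq> 0 \<Longrightarrow> q u \<in> interior K"
  obtains R where "R > 0" "\<And>u. R \<le> norm u \<Longrightarrow> 0 \<le> gerstewitz K e (L u + (1/2) *\<^sub>R q u)"
proof -
  obtain M where M: "M > 0" "\<And>y. gerstewitz K e y \<le> M * norm y"
    by (rule gerstewitz_le_norm) blast
  obtain N where N: "N > 0" "\<And>u. norm (L u) \<le> norm u * N"
    using bounded_linear.pos_bounded[OF L] by blast
  have "continuous_on (sphere 0 1) (\<lambda>u. gerstewitz K e (q u))"
    by (rule continuous_on_compose2[OF continuous_on_gerstewitz[of UNIV]])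
       (auto intro: continuous_on_subset[OF q])
  moreover have "sphere (0::'b) 1 \<noteq> {}"
    by (simp)
  ultimately obtain v :: 'b where v: "v \<in> sphere 0 1"
      "\<And>u. u \<in> sphere 0 1 \<Longrightarrow> gerstewitz K e (q v) \<le> gerstewitz K e (q u)"
    using continuous_attains_inf[OF compact_sphere] by metis
  define m where "m = gerstewitz K e (q v)"
  have m: "m > 0" unfolding m_def using v(1) by (intro gerstewitz_pos pos) auto
  define R where "R = 2 * M * N / m"
  have R: "R > 0" unfolding R_def using M N m by simp
  moreover have "0 \<le> gerstewitz K e (L u + (1/2) *\<^sub>R q u)" if "R \<le> norm u" for u
  proof -
    define s where "s = norm u"
    have s: "s > 0" using that R s_def by linarith
    define w where "w = (1/s) *\<^sub>R u"
    have w: "w \<in> sphere 0 1" "u = s *\<^sub>R w" using s by (auto simp: w_def s_def)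
    have "m * s\<^sup>2 / 2 \<le> (s\<^sup>2 / 2) * gerstewitz K e (q w)"
      using v(2)[OF w(1)] by (simp add: m_def mult_right_mono mult.commute)
    also have "\<dots> = gerstewitz K e ((s\<^sup>2 / 2) *\<^sub>R q w)"
      using s by (intro gerstewitz_scaleR[symmetric]) simp
    also have "(s\<^sup>2 / 2) *\<^sub>R q w = (L u + (1/2) *\<^sub>R q u) + - L u"
      by (simp add: w(2) hom)
    also have "gerstewitz K e \<dots> \<le> gerstewitz K e (L u + (1/2) *\<^sub>R q u) + gerstewitz K e (- L u)"
      by (rule gerstewitz_add_le)
    also have "gerstewitz K e (- L u) \<le> M * (s * N)"
      using order_trans[OF M(2)[of "- L u"]] mult_left_mono[OF N(2)[of u], of M] M(1) by (simp add: s_def)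
    finally have *: "m * s\<^sup>2 / 2 - M * (s * N) \<le> gerstewitz K e (L u + (1/2) *\<^sub>R q u)" by simp
    have "2 * M * N \<le> m * s" using that m by (simp add: R_def s_def field_simps)
    then have "s * (2 * M * N) \<le> s * (m * s)" using s by (intro mult_left_mono) auto
    then show ?thesis using * by (simp add: power2_eq_square algebra_simps)
  qed
  ultimately show thesis by (rule that)
qed

section \<open>Domination by minimal elements\<close>

text \<open>
  Below any element of \<open>A\<close>, an element with the fewest elements of \<open>A\<close> below it is minimal:
  pointedness makes the count drop strictly when one passes to a smaller element.
\<close>

lemma dominated_by_minimal_element:
  assumes "finite A" "y \<in> A"
  obtains z where "z \<in> minimal_elements A K" "y - z \<in> K"
proof -
  define below where "below z = {v \<in> A. z - v \<in> K}" for z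
  define z where "z = arg_min_on (\<lambda>z. card (below z)) (below y)"
  have fin: "finite (below z)" for z using assms(1) by (simp add: below_def)
  have "below y \<noteq> {}" using assms(2) zero_mem by (auto simp: below_def)
  note z = arg_min_if_finite[OF fin this, of "\<lambda>z. card (below z)", folded z_def]
  have zA: "z \<in> A" and yz: "y - z \<in> K" using z(1) by (auto simp: below_def)
  have "v = z" if "v \<in> A" "z - v \<in> K" for v
  proof (rule ccontr)
    assume "v \<noteq> z"
    have le: "y - w \<in> K" if "z - w \<in> K" for w
      using add_mem[OF yz that] by simp
    have "below v \<subseteq> below z"
    proof
      fix w assume "w \<in> below v"
      then show "w \<in> below z"
        using add_mem[OF that(2), of "v - w"] by (auto simp: below_def)
    qed
    moreover have "z \<in> below z - below v"
      using \<open>v \<noteq> z\<close> zA zero_mem that(2) both_signs_imp_zero[of "z - v"] by (auto simp: below_def)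
    ultimately have "card (below v) < card (below z)"
      by (intro psubset_card_mono[OF fin]) auto
    moreover have "v \<in> below y" using that le by (auto simp: below_def)
    ultimately show False using z(2) by blast
  qed
  then have "z \<in> minimal_elements A K"
    unfolding minimal_elements_def using zA zero_mem by (auto intro!: image_eqI[of _ _ 0])
  then show thesis using yz that by blast
qed

text \<open>
  The difference quotients converge to \<open>D u\<close>, which lies in the open set \<open>- interior K\<close>.
\<close>

lemma eventually_descent_along_direction:
  fixes g :: "'b::real_normed_vector \<Rightarrow> 'a"
  assumes D: "(g has_derivative D) (at x)" and descent: "- D u \<in> interior K"
  shows "eventually (\<lambda>t. g x - g (x + t *\<^sub>R u) \<in> interior K) (at_right 0)"
proof -
  have D0: "(g has_derivative D) (at (x + 0 *\<^sub>R u))" using D by simp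
  have "((\<lambda>t. x + t *\<^sub>R u) has_derivative (\<lambda>t. t *\<^sub>R u)) (at 0)"
    by (auto intro!: derivative_eq_intros)
  from has_derivative_compose[OF this D0]
  have "((\<lambda>t. g (x + t *\<^sub>R u)) has_derivative (\<lambda>t. D (t *\<^sub>R u))) (at 0)" .
  then have lim: "((\<lambda>t. norm (g (x + t *\<^sub>R u) - g x - t *\<^sub>R D u) / norm t) \<longlongrightarrow> 0) (at 0)"
    using linear_scale[OF has_derivative_linear[OF D]] by (simp add: has_derivative_at)
  have "((\<lambda>t. (g (x + t *\<^sub>R u) - g x) /\<^sub>R t) \<longlongrightarrow> D u) (at 0)"
  proof (subst tendsto_dist_iff, rule Lim_transform_eventually[OF lim])
    have "norm (g (x + t *\<^sub>R u) - g x - t *\<^sub>R D u) / norm t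
        = dist ((g (x + t *\<^sub>R u) - g x) /\<^sub>R t) (D u)" if "t \<noteq> 0" for t
    proof -
      have "g (x + t *\<^sub>R u) - g x - t *\<^sub>R D u = t *\<^sub>R ((g (x + t *\<^sub>R u) - g x) /\<^sub>R t - D u)"
        using that by (simp add: scaleR_diff_right)
      then show ?thesis using that by (simp add: dist_norm)
    qed
    then show "\<forall>\<^sub>F t in at 0. norm (g (x + t *\<^sub>R u) - g x - t *\<^sub>R D u) / norm t
        = dist ((g (x + t *\<^sub>R u) - g x) /\<^sub>R t) (D u)"
      by (auto simp: eventually_at intro: exI[of _ 1])
  qed
  then have "((\<lambda>t. - ((g (x + t *\<^sub>R u) - g x) /\<^sub>R t)) \<longlongrightarrow> - D u) (at_right 0)"
    using filterlim_at_split by (intro tendsto_minus) blast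
  then have "eventually (\<lambda>t. - ((g (x + t *\<^sub>R u) - g x) /\<^sub>R t) \<in> interior K) (at_right 0)"
    using descent by (rule topological_tendstoD[OF _ open_interior])
  then show ?thesis
    using eventually_at_right_less[of 0]
  proof eventually_elim
    case (elim t)
    then have "t *\<^sub>R - ((g (x + t *\<^sub>R u) - g x) /\<^sub>R t) \<in> interior K"
      by (intro scaleR_mem_interior)
    then show ?case using elim by simp
  qed
qed

end

section \<open>The quadratic model attains its minimum\<close>

lemma transpose_gradient_apply:
  assumes "(g has_derivative D) (at x)"
  shows "transpose (gradient g x) *v u = D u"
proof -
  have "frechet_derivative g (at x) = D" using assms frechet_derivative_at by metis
  then show ?thesis
    using matrix_works[OF linear_matrix_vector_mul_eq[THEN iffD2], OF has_derivative_linear[OF assms]] by (simp add: gradient_def)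
qed

lemma continuous_on_quad_form: "continuous_on S (quad_form H)"
  unfolding quad_form_def
  by (intro continuous_on_vec_lambda continuous_intros linear_continuous_on
      matrix_vector_mul_bounded_linear)

lemma quad_form_scaleR: "quad_form H (c *\<^sub>R u) = c\<^sup>2 *\<^sub>R quad_form H u"
  by (simp add: quad_form_def vec_eq_iff matrix_vector_mult_scaleR power2_eq_square)

lemma continuous_on_Max_image:
  fixes g :: "'i \<Rightarrow> 'a::topological_space \<Rightarrow> real"
  assumes "finite J" "J \<noteq> {}" "\<And>j. j \<in> J \<Longrightarrow> continuous_on S (g j)"
  shows "continuous_on S (\<lambda>u. Max ((\<lambda>j. g j u) ` J))"
  using assms
proof (induction J rule: finite_ne_induct)
  case (insert j J)
  have "Max ((\<lambda>j. g j u) ` insert j J) = max (g j u) (Max ((\<lambda>j. g j u) ` J))" for u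
    using insert.hyps by simp
  then show ?case using insert by (auto intro!: continuous_on_max)
qed simp

lemma finite_set_map: "finite (set_map p f x)"
  by (simp add: set_map_def)

lemma partition_set_component:
  assumes "a \<in> partition_set K p f r x" "j \<in> {1..num_minimal K p f x}"
  shows "a j \<in> {1..p}" "f (a j) x = r x j"
  using assms by (auto simp: partition_set_def active_indices_at_def active_indices_def PiE_iff)

lemma finite_partition_set: "finite (partition_set K p f r x)"
  unfolding partition_set_def
  by (intro finite_PiE) (auto simp: active_indices_at_def active_indices_def)

context
  fixes K :: "(real^'m) set" and e :: "real^'m"
    and p :: nat and f :: "nat \<Rightarrow> real^'n \<Rightarrow> real^'m"
    and B :: "nat \<Rightarrow> real^'n \<Rightarrow> real^'n^'n^'m"
    and r :: "real^'n \<Rightarrow> nat \<Rightarrow> real^'m"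
    and x :: "real^'n"
  assumes K: "solid_pointed_cone K e" and p: "p \<ge> 1"
    and hess: "\<And>i. i \<in> {1..p} \<Longrightarrow> hessian_approximation K (B i x)"
begin

interpretation solid_pointed_cone K e by (rule K)

lemma num_minimal_pos: "num_minimal K p f x \<ge> 1"
proof -
  have "f 1 x \<in> set_map p f x" using p by (auto simp: set_map_def)
  then obtain z where "z \<in> minimal_elements (set_map p f x) K"
    by (rule dominated_by_minimal_element[OF finite_set_map])
  moreover have "finite (minimal_elements (set_map p f x) K)"
    by (rule finite_subset[OF _ finite_set_map]) (auto simp: minimal_elements_def)
  ultimately show ?thesis
    unfolding num_minimal_def by (metis One_nat_def Suc_leI card_gt_0_iff empty_iff)
qed

lemma xi_le_iff:
  "xi K e p f B x a u \<le> c \<longleftrightarrow>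
     (\<forall>j\<in>{1..num_minimal K p f x}. gerstewitz K e
        (transpose (gradient (f (a j)) x) *v u + (1/2) *\<^sub>R quad_form (B (a j) x) u) \<le> c)"
  unfolding xi_def using num_minimal_pos by (subst Max_le_iff) auto

lemma xi_zero_le: "xi K e p f B x a 0 \<le> 0"
  using gerstewitz_zero_le by (simp add: xi_le_iff quad_form_def zero_vec_def[symmetric])

text \<open>
  The value at \<open>0\<close> is at most \<open>0\<close>, and far out a single component already keeps the maximum
  nonnegative. A minimiser over a large ball is therefore a global one.
\<close>

lemma xi_attains_min:
  assumes a: "a \<in> partition_set K p f r x"
  obtains v where "\<And>u. xi K e p f B x a v \<le> xi K e p f B x a u"
proof -
  let ?model = "\<lambda>j u. transpose (gradient (f (a j)) x) *v u + (1/2) *\<^sub>R quad_form (B (a j) x) u"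
  have J: "1 \<in> {1..num_minimal K p f x}" using num_minimal_pos by simp
  have "quad_form (B (a 1) x) u \<in> interior K" if "u \<noteq> 0" for u
    using hess[OF partition_set_component(1)[OF a J]] that by (simp add: hessian_approximation_def)
  then obtain R where R: "R > 0" "\<And>u. R \<le> norm u \<Longrightarrow> 0 \<le> gerstewitz K e (?model 1 u)"
    using quadratic_model_nonneg_outside_ball[OF matrix_vector_mul_bounded_linear
      continuous_on_quad_form quad_form_scaleR] by metis
  have "continuous_on (cball 0 R) (xi K e p f B x a)"
    unfolding xi_def using J
    by (intro continuous_on_Max_image continuous_on_compose2[OF continuous_on_gerstewitz[of UNIV]]
        continuous_intros linear_continuous_on matrix_vector_mul_bounded_linear
        continuous_on_quad_form) auto
  moreover have "cball (0 :: real^'n) R \<noteq> {}" using R(1) by simp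
  ultimately obtain v where v:
      "\<And>u. u \<in> cball 0 R \<Longrightarrow> xi K e p f B x a v \<le> xi K e p f B x a u"
    using continuous_attains_inf[OF compact_cball] by metis
  have "xi K e p f B x a v \<le> xi K e p f B x a u" for u
  proof (cases "u \<in> cball 0 R")
    case False
    have "xi K e p f B x a v \<le> 0"
      using v[of 0] xi_zero_le[of a] R(1) by simp
    also have "0 \<le> gerstewitz K e (?model 1 u)" using R(2) False by simp
    also have "\<dots> \<le> xi K e p f B x a u" using J xi_le_iff[of a u] by blast
    finally show ?thesis .
  qed (rule v)
  then show thesis by (rule that)
qed

text \<open>
  Minimising over the finitely many tuples the minima over \<open>u\<close> shows that the least value in
  the definition of \<open>Phi\<close> exists, so that \<open>Phi\<close> is a lower bound.
\<close>

lemma Phi_le_xi: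
  assumes a: "a \<in> partition_set K p f r x"
  shows "Phi K e p f B r x \<le> xi K e p f B x a u"
proof -
  let ?P = "partition_set K p f r x" and ?xi = "xi K e p f B x"
  have "\<exists>v. \<forall>u. ?xi a v \<le> ?xi a u" if "a \<in> ?P" for a
    using xi_attains_min[OF that] by metis
  then obtain v where v: "\<And>a u. a \<in> ?P \<Longrightarrow> ?xi a (v a) \<le> ?xi a u" by metis
  define b where "b = arg_min_on (\<lambda>a. ?xi a (v a)) ?P"
  have "?P \<noteq> {}" using a by auto
  note b = arg_min_if_finite(1)[OF finite_partition_set this, of "\<lambda>a. ?xi a (v a)", folded b_def]
    arg_min_least[OF finite_partition_set this, of _ "\<lambda>a. ?xi a (v a)", folded b_def]
  have least: "?xi b (v b) \<le> ?xi a u" if "a \<in> ?P" for a u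
    using b(2)[OF that] v[OF that] by (rule order_trans)
  have "Phi K e p f B r x = ?xi b (v b)"
    unfolding Phi_def
  proof (rule Least_equality)
    show "?xi b (v b) \<in> (\<lambda>(a, u). ?xi a u) ` (?P \<times> UNIV)" using b(1) by force
  qed (use least in auto)
  then show ?thesis using least[OF a] by simp
qed

end

section \<open>Stationarity of weakly minimal solutions\<close>

theorem proposition3p10:
  fixes K :: "(real^'m) set" and e :: "real^'m"
    and p :: nat and f :: "nat \<Rightarrow> real^'n \<Rightarrow> real^'m"
    and B :: "nat \<Rightarrow> real^'n \<Rightarrow> real^'n^'n^'m"
    and r :: "real^'n \<Rightarrow> nat \<Rightarrow> real^'m"
    and xbar ubar :: "real^'n" and abar :: "nat \<Rightarrow> nat"
  assumes "closed K" and "convex K" and "cone K" and "pointed K"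
    and "interior K \<noteq> {}" and "e \<in> interior K"
    and "p \<ge> 1"
    and "\<And>i. i \<in> {1..p} \<Longrightarrow> twice_continuously_differentiable (f i)"
    and "\<And>i x. i \<in> {1..p} \<Longrightarrow> hessian_approximation K (B i x)"
    and "minimal_enumeration K p f r"
    and "weakly_minimal_solution K (set_map p f) xbar"
    and "abar \<in> partition_set K p f r xbar"
    and "Phi K e p f B r xbar = xi K e p f B xbar abar ubar"
  shows "ubar = 0"
proof (rule ccontr)
  assume "ubar \<noteq> 0"
  interpret solid_pointed_cone K e
    using assms by unfold_locales
  let ?w = "num_minimal K p f xbar"
  let ?D = "\<lambda>i. frechet_derivative (f i) (at xbar)"
  have der: "(f i has_derivative ?D i) (at xbar)" if "i \<in> {1..p}" for i
    using assms(8)[OF that] unfolding twice_continuously_differentiable_def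
    by (metis differentiableI frechet_derivative_works)
  have "xi K e p f B xbar abar ubar \<le> xi K e p f B xbar abar 0"
    using Phi_le_xi[OF solid_pointed_cone_axioms assms(7), where B = B and x = xbar and u = 0,
        OF assms(9,12)] assms(13) by simp
  also have "\<dots> \<le> 0"
    by (rule xi_zero_le[OF solid_pointed_cone_axioms assms(7,9)])
  finally have nonpos: "xi K e p f B xbar abar ubar \<le> 0" .
  note model_le_iff = xi_le_iff[OF solid_pointed_cone_axioms assms(7), where B = B and x = xbar,
      OF assms(9)]
  \<comment> \<open>Half the quadratic term is interior to \<open>K\<close>; removing it from the model value, which lies in
    \<open>- K\<close>, leaves the linear term in the interior of \<open>- K\<close>.\<close>
  have descent: "- ?D (abar j) ubar \<in> interior K" if j: "j \<in> {1..?w}" for j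
  proof -
    let ?q = "quad_form (B (abar j) xbar) ubar"
    have i: "abar j \<in> {1..p}" by (rule partition_set_component(1)[OF assms(12) j])
    have "gerstewitz K e (?D (abar j) ubar + (1/2) *\<^sub>R ?q) \<le> 0"
      using bspec[OF iffD1[OF model_le_iff nonpos] j]
      by (simp only: transpose_gradient_apply[OF der[OF i]])
    then have "- (?D (abar j) ubar + (1/2) *\<^sub>R ?q) \<in> K"
      by (simp add: gerstewitz_le_iff)
    moreover have "(1/2) *\<^sub>R ?q \<in> interior K"
      using assms(9)[OF i] \<open>ubar \<noteq> 0\<close>
      by (intro scaleR_mem_interior) (auto simp: hessian_approximation_def)
    ultimately have "(1/2) *\<^sub>R ?q + - (?D (abar j) ubar + (1/2) *\<^sub>R ?q) \<in> interior K"
      by (rule add_mem_interior[rotated])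
    then show ?thesis by simp
  qed
  have "\<forall>\<^sub>F t in at_right 0.
      \<forall>j\<in>{1..?w}. f (abar j) xbar - f (abar j) (xbar + t *\<^sub>R ubar) \<in> interior K"
    by (intro eventually_ball_finite ballI finite_atLeastAtMost
        eventually_descent_along_direction[OF der[OF partition_set_component(1)[OF assms(12)]]]
        descent)
  from eventually_happens'[OF trivial_limit_at_right_real this] obtain t where t:
      "\<And>j. j \<in> {1..?w} \<Longrightarrow> f (abar j) xbar - f (abar j) (xbar + t *\<^sub>R ubar) \<in> interior K"
    by blast
  have "lower_less K (set_map p f (xbar + t *\<^sub>R ubar)) (set_map p f xbar)"
    unfolding lower_less_def
  proof
    fix y assume "y \<in> set_map p f xbar"
    then obtain z where z: "z \<in> minimal_elements (set_map p f xbar) K" "y - z \<in> K"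
      by (rule dominated_by_minimal_element[OF finite_set_map])
    then obtain j where j: "j \<in> {1..?w}" "z = r xbar j"
      using assms(10) unfolding minimal_enumeration_def bij_betw_def by blast
    note a = partition_set_component[OF assms(12) j(1)]
    \<comment> \<open>The new value of the component that selects \<open>z\<close> lies strictly below \<open>z\<close>, hence below \<open>y\<close>.\<close>
    let ?new = "f (abar j) (xbar + t *\<^sub>R ubar)"
    have "(z - ?new) + (y - z) \<in> interior K"
      using t[OF j(1)] a(2) j(2) z(2) by (intro add_mem_interior) auto
    moreover have "?new \<in> set_map p f (xbar + t *\<^sub>R ubar)"
      using a(1) by (auto simp: set_map_def)
    ultimately show "y \<in> set_map p f (xbar + t *\<^sub>R ubar) + interior K"
      using set_plus_intro[of ?new _ "y - ?new"] by simp
  qed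
  then show False using assms(11) by (auto simp: weakly_minimal_solution_def)
qed

end
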